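(* Assume that $\sum_{n=1}^\infty(x_n,y_n)$ is a conditionally convergent series in $\mathbb{R}^2$ which has the reduction property. Then $\mathrm{A}(x_n,y_n)=\mathbb{R}^2$.
   Context: A series in $\mathbb{R}^2$ is conditionally convergent if it converges but the series of norms of its terms diverges. The achievement set of $\sum_{n=1}^\infty v_n$ ($v_n\in\mathbb{R}^2$) is $\mathrm{A}(v_n)=\{\sum_{n=1}^\infty\varepsilon_nv_n:\ (\varepsilon_n)\in\{0,1\}^{\mathbb{N}},\ \sum_{n=1}^\infty\varepsilon_nv_n\text{ converges}\}$; here $v_n=(x_n,y_n)$. The series $\sum_{n=1}^\infty(x_n,y_n)$ has the reduction property if $\lim_{n\to\infty}\frac{|y_n|}{|x_n|}=\infty$ and for every $\varepsilon>0$, every $x\in(-\varepsilon,\varepsilon)$ and every $N\in\mathbb{N}$ there exists a finite set of indices $A=\{k_1<k_2<\dots<k_m\}$ with $k_1\ge N$ such that $\left|\sum_{n\in A}x_n-x\right|<\frac{\varepsilon}{2}$, $\max_{1\le j\le m}\left|\sum_{n=1}^jx_{k_n}\right|<\varepsilon$ and $\max_{1\le j\le m}\left|\sum_{n=1}^jy_{k_n}\right|<\varepsilon$. *)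

theory Defs
  imports "HOL-Analysis.Analysis"
begin

text \<open>
  Series are indexed from 0, i.e. the term written with index n + 1 on paper is the value at n.
  The plane is \<^typ>\<open>real \<times> real\<close>, whose norm in the library is the Euclidean one.
\<close>

definition conditionally_convergent :: "(nat \<Rightarrow> 'a::real_normed_vector) \<Rightarrow> bool" where
  "conditionally_convergent v \<longleftrightarrow> summable v \<and> \<not> summable (\<lambda>n. norm (v n))"

definition achievement_set :: "(nat \<Rightarrow> 'a::real_normed_vector) \<Rightarrow> 'a set" where
  "achievement_set v =
    {(\<Sum>n. e n *\<^sub>R v n) | e :: nat \<Rightarrow> real. (\<forall>n. e n \<in> {0, 1}) \<and> summable (\<lambda>n. e n *\<^sub>R v n)}"

text \<open>
  Since division by zero yields zero, the divergence of the quotients forces \<open>x n \<noteq> 0\<close> for all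
  large n, i.e. that the quotients are eventually meaningful.  The function \<open>k\<close> enumerates \<open>A\<close>
  increasingly as \<open>k 1 < \<dots> < k m\<close>; its values outside \<open>{1..m}\<close> are irrelevant.
\<close>

definition reduction_property :: "(nat \<Rightarrow> real) \<Rightarrow> (nat \<Rightarrow> real) \<Rightarrow> bool" where
  "reduction_property x y \<longleftrightarrow>
    filterlim (\<lambda>n. \<bar>y n\<bar> / \<bar>x n\<bar>) at_top sequentially \<and>
    (\<forall>\<epsilon>>0. \<forall>t\<in>{-\<epsilon><..<\<epsilon>}. \<forall>N. \<exists>(A :: nat set) (k :: nat \<Rightarrow> nat) (m :: nat).
      m \<ge> 1 \<and> strict_mono_on {1..m} k \<and> A = k ` {1..m} \<and> k 1 \<ge> N \<and>
      \<bar>(\<Sum>n\<in>A. x n) - t\<bar> < \<epsilon> / 2 \<and>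
      (MAX j\<in>{1..m}. \<bar>\<Sum>n=1..j. x (k n)\<bar>) < \<epsilon> \<and>
      (MAX j\<in>{1..m}. \<bar>\<Sum>n=1..j. y (k n)\<bar>) < \<epsilon>)"

end

theory Submission
  imports Defs
begin

text \<open>
  Fix a target and select indices in blocks, each lying beyond the previous one.  Call the target
  minus the sum selected so far the \<^emph>\<open>error\<close>.  If the error has norm below \<open>\<epsilon>\<close>, one block
  brings it below \<open>3\<epsilon>/4\<close>, and the sums over initial pieces of the block stay of order
  \<open>\<epsilon>\<close>.  Repeating this makes the errors at block ends decay geometrically, and the second
  property makes the errors inside the blocks vanish as well, so the selected subseries converges
  to the target (\<open>achievement_set_if_error_reducible\<close>).

  A block has two parts.  The reduction property supplies a finite set of indices that cuts the first
  coordinate of the error below \<open>\<epsilon>/2\<close> while the second coordinate grows to at most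
  \<open>2\<epsilon>\<close>.  The second coordinate is then repaired alone.  Since \<open>x n\<close> is eventually dominated
  by \<open>y n\<close>, the divergence of the series of norms is due to \<open>y\<close>, so \<open>y\<close> is conditionally
  convergent; as in Riemann's rearrangement theorem, terms of one sign, taken from arbitrarily far out,
  approximate any real number \<open>q\<close> (\<open>approximation_by_one_sign\<close>).  No cancellation occurs among
  these terms, so their absolute values add up to at most \<open>\<bar>q\<bar> \<le> 2\<epsilon>\<close>.  Because
  \<open>\<bar>x n\<bar> \<le> \<bar>y n\<bar> / 16\<close> far out, the repair moves the first coordinate by at most
  \<open>\<epsilon>/8\<close>, which does not spoil the gain (\<open>block_reducing_error\<close>).
\<close>

section \<open>Converging to a target by reducing the error blockwise\<close>

text \<open>
  Iterating the reduction of the error gives blocks with union \<open>T\<close>.  The error before an index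
  inside the \<open>i\<close>-th block is at most the error at its start plus the sum over an initial piece
  of the block, hence at most \<open>(1 + C) * c ^ i\<close> times a constant; this tends to zero.
\<close>

lemma achievement_set_if_error_reducible:
  fixes v :: "nat \<Rightarrow> 'a::real_normed_vector"
  assumes c: "0 < c" "c < 1" and C: "0 \<le> C"
    and reduce: "\<And>p \<epsilon> N. norm p < \<epsilon> \<Longrightarrow> \<exists>B. finite B \<and> B \<subseteq> {N..} \<and>
      norm (p - sum v B) < c * \<epsilon> \<and> (\<forall>n. norm (sum v (B \<inter> {..<n})) \<le> C * \<epsilon>)"
  shows "t \<in> achievement_set v"
proof -
  define r where "r i = (norm t + 1) * c ^ i" for i
  have r_decr: "r j \<le> r i" if "i \<le> j" for i j
    unfolding r_def using c that by (intro mult_left_mono power_decreasing) auto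
  define P where "P i s \<longleftrightarrow> snd s \<subseteq> {..<fst s} \<and> norm (t - sum v (snd s)) < r i"
    for i and s :: "nat \<times> nat set"
  define Q where "Q i s s' \<longleftrightarrow> fst s < fst s' \<and> snd s' \<inter> {..<fst s} = snd s \<and>
      (\<forall>n\<ge>fst s. norm (t - sum v (snd s' \<inter> {..<n})) \<le> (1 + C) * r i)"
    for i and s s' :: "nat \<times> nat set"
  have "\<exists>f. \<forall>i. P i (f i) \<and> Q i (f i) (f (Suc i))"
  proof (rule dependent_nat_choice)
    show "\<exists>s. P 0 s"
      by (rule exI[of _ "(0, {})"]) (simp add: P_def r_def)
  next
    fix s i assume "P i s"
    then obtain N S where s: "s = (N, S)" and S: "S \<subseteq> {..<N}" and lt: "norm (t - sum v S) < r i"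
      unfolding P_def by (cases s) auto
    from reduce[OF lt, of N] obtain B where B: "finite B" "B \<subseteq> {N..}"
      "norm ((t - sum v S) - sum v B) < c * r i"
      and piece: "\<And>n. norm (sum v (B \<inter> {..<n})) \<le> C * r i" by blast
    have finS: "finite S" using S finite_subset by blast
    have sum_ext: "sum v ((S \<union> B) \<inter> {..<n}) = sum v S + sum v (B \<inter> {..<n})" if "n \<ge> N" for n
    proof -
      have "(S \<union> B) \<inter> {..<n} = S \<union> (B \<inter> {..<n})" "S \<inter> (B \<inter> {..<n}) = {}"
        using S B(2) that by force+
      then show ?thesis using finS B(1) by (simp add: sum.union_disjoint)
    qed
    obtain M where M: "M > N" "B \<subseteq> {..<M}"
    proof
      show "Suc (Max (insert N B)) > N" "B \<subseteq> {..<Suc (Max (insert N B))}"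
        using B(1) by (auto simp: less_Suc_eq_le)
    qed
    have "P (Suc i) (M, S \<union> B)"
    proof -
      have "S \<inter> B = {}" using S B(2) by force
      then have "sum v (S \<union> B) = sum v S + sum v B"
        using finS B(1) by (simp add: sum.union_disjoint)
      moreover have "r (Suc i) = c * r i" by (simp add: r_def)
      ultimately show ?thesis
        using S M B(3) unfolding P_def by (auto simp: diff_diff_eq)
    qed
    moreover have "Q i s (M, S \<union> B)"
    proof -
      have "norm (t - sum v ((S \<union> B) \<inter> {..<n})) \<le> (1 + C) * r i" if "n \<ge> N" for n
      proof -
        have "norm ((t - sum v S) - sum v (B \<inter> {..<n})) \<le> r i + C * r i"
          using lt piece[of n] norm_triangle_ineq4[of "t - sum v S" "sum v (B \<inter> {..<n})"] by linarith
        then show ?thesis by (simp add: sum_ext[OF that] diff_diff_eq algebra_simps)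
      qed
      moreover have "(S \<union> B) \<inter> {..<N} = S" using S B(2) by force
      ultimately show ?thesis using M by (simp add: Q_def s)
    qed
    ultimately show "\<exists>s'. P (Suc i) s' \<and> Q i s s'" by blast
  qed
  then obtain f where "\<forall>i. P i (f i) \<and> Q i (f i) (f (Suc i))" ..
  then have f: "\<And>i. P i (f i)" "\<And>i. Q i (f i) (f (Suc i))" by auto
  define N S where "N = fst \<circ> f" and "S = snd \<circ> f"
  have below: "S i \<subseteq> {..<N i}" for i
    using f(1)[of i] by (simp add: P_def N_def S_def)
  have N_mono: "strict_mono N"
    unfolding strict_mono_Suc_iff using f(2) by (simp add: Q_def N_def)
  have S_step: "S (Suc i) \<inter> {..<N i} = S i" for i
    using f(2)[of i] by (simp add: Q_def N_def S_def)
  have err: "norm (t - sum v (S (Suc i) \<inter> {..<n})) \<le> (1 + C) * r i" if "n \<ge> N i" for i n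
    using f(2)[of i] that by (simp add: Q_def N_def S_def)
  define T where "T = (\<Union>i. S i)"
  \<comment> \<open>Later blocks do not change the selection below the end of an earlier one.\<close>
  have S_stable: "S (i + j) \<inter> {..<N i} = S i" for i j
  proof (induction j)
    case 0
    show ?case using below by auto
  next
    case (Suc j)
    have "N i \<le> N (i + j)" using N_mono by (simp add: strict_mono_less_eq)
    then show ?case using S_step[of "i + j"] Suc by fastforce
  qed
  have T_below: "T \<inter> {..<N i} = S i" for i
  proof
    show "S i \<subseteq> T \<inter> {..<N i}" using below by (auto simp: T_def)
    show "T \<inter> {..<N i} \<subseteq> S i"
    proof
      fix n assume "n \<in> T \<inter> {..<N i}"
      then obtain j where j: "n \<in> S j" "n < N i" by (auto simp: T_def)
      show "n \<in> S i"
      proof (cases "j \<le> i")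
        case True
        then show ?thesis using S_stable[of j "i - j"] j by auto
      next
        case False
        then show ?thesis using S_stable[of i "j - i"] j by auto
      qed
    qed
  qed
  have tail: "norm (t - sum v (T \<inter> {..<n})) \<le> (1 + C) * r i" if n: "n \<ge> N i" for i n
  proof -
    \<comment> \<open>\<open>j\<close> numbers the block chosen from an index range that contains \<open>n\<close>.\<close>
    obtain j where j: "i \<le> j" "N j \<le> n" "n < N (Suc j)"
    proof -
      define k where "k = (LEAST k. n < N k)"
      have "n < N (Suc n)" using seq_suble[OF N_mono, of "Suc n"] by simp
      then have k: "n < N k" unfolding k_def by (rule LeastI)
      then have "N i < N k" using n by simp
      then have "i < k" using N_mono by (simp add: strict_mono_less)
      moreover have "\<not> n < N (k - 1)"
        using \<open>i < k\<close> unfolding k_def by (intro not_less_Least) simp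
      ultimately show thesis using that[of "k - 1"] k by simp
    qed
    have "T \<inter> {..<n} = T \<inter> {..<N (Suc j)} \<inter> {..<n}"
      using j(3) by auto
    then have "T \<inter> {..<n} = S (Suc j) \<inter> {..<n}" by (simp only: T_below)
    then have "norm (t - sum v (T \<inter> {..<n})) \<le> (1 + C) * r j" using err[OF j(2)] by simp
    also have "\<dots> \<le> (1 + C) * r i" using r_decr[OF j(1)] C by (intro mult_left_mono) auto
    finally show ?thesis .
  qed
  have bound_lim: "(\<lambda>i. (1 + C) * r i) \<longlonglongrightarrow> 0"
    unfolding r_def using c by (intro tendsto_mult_right_zero LIMSEQ_power_zero) auto
  have r_small: "\<exists>i. (1 + C) * r i < \<delta>" if "\<delta> > 0" for \<delta>
    by (rule eventually_happens'[OF sequentially_bot order_tendstoD(2)[OF bound_lim that]])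
  have "(\<lambda>n. sum v (T \<inter> {..<n})) \<longlonglongrightarrow> t"
  proof (rule LIMSEQ_I)
    fix \<delta> :: real assume "\<delta> > 0"
    then obtain i where i: "(1 + C) * r i < \<delta>" using r_small by blast
    show "\<exists>no. \<forall>n\<ge>no. norm (sum v (T \<inter> {..<n}) - t) < \<delta>"
      using le_less_trans[OF tail[of i] i]
      by (intro exI[of _ "N i"]) (simp add: norm_minus_commute)
  qed
  moreover have "(\<Sum>k<n. indicator T k *\<^sub>R v k) = sum v (T \<inter> {..<n})" for n
    unfolding Int_commute[of T] sum.inter_restrict[OF finite_lessThan]
    by (intro sum.cong) (auto simp: indicator_def)
  ultimately have sums: "(\<lambda>n. indicator T n *\<^sub>R v n) sums t" by (simp add: sums_def)
  show ?thesis
    unfolding achievement_set_def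
    using sums by (intro CollectI exI[of _ "indicator T"]) (auto simp: sums_iff indicator_def)
qed

section \<open>Approximation by terms of one sign\<close>

text \<open>
  If the positive terms had a finite sum, then so would the negative ones, as the difference
  of a summable series and the given one, and the series would converge absolutely.
\<close>

lemma not_summable_positive_part:
  fixes y :: "nat \<Rightarrow> real"
  assumes "summable y" "\<not> summable (\<lambda>n. \<bar>y n\<bar>)"
  shows "\<not> summable (\<lambda>n. max (y n) 0)"
proof
  assume "summable (\<lambda>n. max (y n) 0)"
  then have "summable (\<lambda>n. 2 * max (y n) 0 - y n)"
    using assms(1) by (intro summable_diff summable_mult)
  moreover have "2 * max (y n) 0 - y n = \<bar>y n\<bar>" for n by simp
  ultimately show False using assms(2) by simp
qed

text \<open>
  The partial sums from a far enough start pass \<open>q\<close> in steps shorter than \<open>\<delta>\<close>; stop just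
  before they do.
\<close>

lemma block_of_divergent_series_approximates:
  fixes u :: "nat \<Rightarrow> real"
  assumes "\<And>n. u n \<ge> 0" "\<not> summable u" "u \<longlonglongrightarrow> 0" "q \<ge> 0" "\<delta> > 0"
  shows "\<exists>K M. N \<le> K \<and> sum u {K..<M} \<le> q \<and> q < sum u {K..<M} + \<delta>"
proof -
  have "eventually (\<lambda>n. u n < \<delta>) sequentially"
    using assms(3,5) by (intro order_tendstoD)
  then obtain K0 where K0: "\<And>n. n \<ge> K0 \<Longrightarrow> u n < \<delta>" by (auto simp: eventually_sequentially)
  define K where "K = max N K0"
  have "\<not> summable (\<lambda>n. u (n + K))" using assms(2) by simp
  then have "\<exists>n. q < (\<Sum>i<n. u (i + K))"
    using summableI_nonneg_bounded[of "\<lambda>n. u (n + K)" q] assms(1) by (meson leI)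
  define n where "n = (LEAST n. q < (\<Sum>i<n. u (i + K)))"
  have n: "q < (\<Sum>i<n. u (i + K))"
    unfolding n_def by (rule LeastI_ex) fact
  with assms(4) obtain m where m: "n = Suc m" by (cases n) auto
  have "\<not> q < (\<Sum>i<m. u (i + K))"
    using not_less_Least[of m "\<lambda>n. q < (\<Sum>i<n. u (i + K))"] m n_def by simp
  moreover have "u (m + K) < \<delta>" by (rule K0) (simp add: K_def)
  moreover have "(\<Sum>i<m. u (i + K)) = sum u {K..<m + K}"
    using sum.shift_bounds_nat_ivl[of u 0 K m] by (simp add: lessThan_atLeast0)
  ultimately have "sum u {K..<m + K} \<le> q" "q < sum u {K..<m + K} + \<delta>"
    using n by (auto simp: m)
  then show ?thesis by (intro exI[of _ K] exI[of _ "m + K"]) (auto simp: K_def)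
qed

text \<open>
  The terms used all have the sign of \<open>q\<close>; the bound on the sum of their absolute values
  is what keeps a sequence dominated by \<open>y\<close> under control.
\<close>

lemma approximation_by_one_sign:
  fixes y :: "nat \<Rightarrow> real"
  assumes "summable y" "\<not> summable (\<lambda>n. \<bar>y n\<bar>)" "\<delta> > 0"
  shows "\<exists>B. finite B \<and> B \<subseteq> {N..} \<and> \<bar>q - sum y B\<bar> < \<delta> \<and> (\<Sum>n\<in>B. \<bar>y n\<bar>) \<le> \<bar>q\<bar>"
proof -
  have nonneg: "\<exists>B. finite B \<and> B \<subseteq> {N..} \<and> \<bar>q - sum y B\<bar> < \<delta> \<and> (\<Sum>n\<in>B. \<bar>y n\<bar>) \<le> \<bar>q\<bar>"
    if y: "summable y" "\<not> summable (\<lambda>n. \<bar>y n\<bar>)" and q: "q \<ge> 0" for y :: "nat \<Rightarrow> real" and q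
  proof -
    have "(\<lambda>n. max (y n) 0) \<longlonglongrightarrow> max 0 0"
      using summable_LIMSEQ_zero[OF y(1)] by (intro tendsto_max) auto
    then obtain K M where KM: "N \<le> K" "(\<Sum>n=K..<M. max (y n) 0) \<le> q"
      "q < (\<Sum>n=K..<M. max (y n) 0) + \<delta>"
      using block_of_divergent_series_approximates[of "\<lambda>n. max (y n) 0" q \<delta> N]
        not_summable_positive_part[OF y] q assms(3) by auto
    define B where "B = {n \<in> {K..<M}. y n > 0}"
    have abs_B: "(\<Sum>n\<in>B. \<bar>y n\<bar>) = sum y B"
      by (intro sum.cong) (auto simp: B_def)
    have "sum y B = (\<Sum>n=K..<M. max (y n) 0)"
      unfolding B_def sum.inter_filter[OF finite_atLeastLessThan]
      by (intro sum.cong) auto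
    with KM abs_B q have "\<bar>q - sum y B\<bar> < \<delta>" "(\<Sum>n\<in>B. \<bar>y n\<bar>) \<le> \<bar>q\<bar>" by auto
    moreover have "finite B" "B \<subseteq> {N..}" using KM(1) by (auto simp: B_def)
    ultimately show ?thesis by blast
  qed
  show ?thesis
  proof (cases "q \<ge> 0")
    case True
    then show ?thesis using nonneg assms by blast
  next
    case False
    have "summable (\<lambda>n. - y n)" "\<not> summable (\<lambda>n. \<bar>- y n\<bar>)"
      using assms by (simp_all add: summable_minus)
    from nonneg[OF this, of "- q"] False obtain B where "finite B" "B \<subseteq> {N..}"
      "\<bar>- q - (\<Sum>n\<in>B. - y n)\<bar> < \<delta>" "(\<Sum>n\<in>B. \<bar>y n\<bar>) \<le> \<bar>q\<bar>" by auto
    moreover have "\<bar>- q - (\<Sum>n\<in>B. - y n)\<bar> = \<bar>q - sum y B\<bar>" by (simp add: sum_negf)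
    ultimately show ?thesis by auto
  qed
qed

section \<open>Reducing the error in the plane\<close>

lemma initial_piece_of_enumerated_set:
  fixes k :: "nat \<Rightarrow> nat"
  assumes "strict_mono_on {1..m} k"
  shows "\<exists>j\<le>m. k ` {1..m} \<inter> {..<n} = k ` {1..j}"
  using assms
proof (induction m)
  case 0
  then show ?case by simp
next
  case (Suc m)
  show ?case
  proof (cases "k (Suc m) < n")
    case True
    have "k i < n" if "i \<in> {1..Suc m}" for i
      using strict_mono_onD[OF Suc.prems, of i "Suc m"] that True
      by (cases "i = Suc m") auto
    then show ?thesis by (intro exI[of _ "Suc m"]) auto
  next
    case False
    have "strict_mono_on {1..m} k"
      using Suc.prems by (rule monotone_on_subset) auto
    moreover have "k ` {1..Suc m} \<inter> {..<n} = k ` {1..m} \<inter> {..<n}"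
      using False by (auto simp: atLeastAtMostSuc_conv)
    ultimately show ?thesis using Suc.IH by (metis le_SucI)
  qed
qed

text \<open>
  The enumeration in the reduction property serves only to speak of initial pieces of the set;
  cutting the set at an index expresses the same bounds without it.
\<close>

lemma reduction_property_finite_set:
  assumes "reduction_property x y" "\<bar>t\<bar> < \<epsilon>"
  obtains A where "finite A" "A \<subseteq> {N..}" "\<bar>sum x A - t\<bar> < \<epsilon> / 2"
    "\<And>n. \<bar>sum x (A \<inter> {..<n})\<bar> < \<epsilon>" "\<And>n. \<bar>sum y (A \<inter> {..<n})\<bar> < \<epsilon>"
proof -
  have eps: "\<epsilon> > 0" and t: "t \<in> {-\<epsilon><..<\<epsilon>}" using assms(2) by auto
  obtain A and k :: "nat \<Rightarrow> nat" and m where m: "m \<ge> 1" and k: "strict_mono_on {1..m} k" and A: "A = k ` {1..m}"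
    and N: "k 1 \<ge> N" and sumA: "\<bar>sum x A - t\<bar> < \<epsilon> / 2"
    and mx: "(MAX j\<in>{1..m}. \<bar>\<Sum>n=1..j. x (k n)\<bar>) < \<epsilon>"
    and my: "(MAX j\<in>{1..m}. \<bar>\<Sum>n=1..j. y (k n)\<bar>) < \<epsilon>"
    using assms(1)[unfolded reduction_property_def, THEN conjunct2, rule_format, OF eps t, of N]
    by blast
  have piece: "\<bar>sum z (A \<inter> {..<n})\<bar> < \<epsilon>"
    if mz: "(MAX j\<in>{1..m}. \<bar>\<Sum>n=1..j. z (k n)\<bar>) < \<epsilon>" for z :: "nat \<Rightarrow> real" and n
  proof -
    obtain j where j: "j \<le> m" "A \<inter> {..<n} = k ` {1..j}"
      using initial_piece_of_enumerated_set[OF k] A by blast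
    have "inj_on k {1..j}"
      using strict_mono_on_imp_inj_on[OF k] j(1) by (auto intro: inj_on_subset)
    then have sum_j: "sum z (A \<inter> {..<n}) = (\<Sum>n=1..j. z (k n))"
      by (simp add: j(2) sum.reindex)
    show ?thesis
    proof (cases "j = 0")
      case True
      then show ?thesis using sum_j eps by simp
    next
      case False
      then have "j \<in> {1..m}" using j(1) by auto
      then have "\<bar>\<Sum>n=1..j. z (k n)\<bar> \<le> (MAX j\<in>{1..m}. \<bar>\<Sum>n=1..j. z (k n)\<bar>)"
        by (intro Max_ge) auto
      then show ?thesis using sum_j mz by linarith
    qed
  qed
  have "N \<le> k i" if "i \<in> {1..m}" for i
    using strict_mono_onD[OF k, of 1 i] that N m by (cases "i = 1") auto
  then have "A \<subseteq> {N..}" using A by auto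
  moreover have "finite A" using A by simp
  ultimately show thesis using that[OF _ _ sumA piece[OF mx] piece[OF my]] by simp
qed

text \<open>
  The reduction property treats the first coordinate, terms of \<open>y\<close> of one sign then treat the
  second.  These terms change the first coordinate by at most \<open>\<epsilon>/8\<close>, and they leave an
  error of at most \<open>\<epsilon>/8\<close> in the second; together with \<open>\<epsilon>/2\<close> this
  gives the factor \<open>3/4\<close>.
\<close>

lemma block_reducing_error:
  fixes x y :: "nat \<Rightarrow> real" and p :: "real \<times> real"
  assumes red: "reduction_property x y"
    and y: "summable y" "\<not> summable (\<lambda>n. \<bar>y n\<bar>)"
    and dom: "\<And>n. n \<ge> K \<Longrightarrow> \<bar>x n\<bar> \<le> \<bar>y n\<bar> / 16"
    and p: "norm p < \<epsilon>"
  defines "v \<equiv> \<lambda>n. (x n, y n)"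
  shows "\<exists>B. finite B \<and> B \<subseteq> {N..} \<and> norm (p - sum v B) < 3 / 4 * \<epsilon> \<and>
    (\<forall>n. norm (sum v (B \<inter> {..<n})) \<le> 5 * \<epsilon>)"
proof -
  obtain a b where ab: "p = (a, b)" by fastforce
  have sum_v: "sum v B = (sum x B, sum y B)" for B by (simp add: v_def sum_prod)
  have a: "\<bar>a\<bar> < \<epsilon>" and b: "\<bar>b\<bar> < \<epsilon>"
    using p norm_fst_le[of a b] norm_snd_le[of b a] by (auto simp: ab)
  then have eps: "\<epsilon> > 0" by linarith
  obtain A where A: "finite A" "A \<subseteq> {N..}" "\<bar>sum x A - a\<bar> < \<epsilon> / 2"
    and Ax: "\<And>n. \<bar>sum x (A \<inter> {..<n})\<bar> < \<epsilon>" and Ay: "\<And>n. \<bar>sum y (A \<inter> {..<n})\<bar> < \<epsilon>"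
    using reduction_property_finite_set[OF red a, of N] by blast
  define L where "L = Suc (Max (insert (max N K) A))"
  have L: "A \<subseteq> {..<L}" "N \<le> L" "K \<le> L"
  proof -
    have "z < L" if "z \<in> insert (max N K) A" for z
      using that A(1) unfolding L_def by (simp add: less_Suc_eq_le)
    from this[of "max N K"] this show "A \<subseteq> {..<L}" "N \<le> L" "K \<le> L" by auto
  qed
  define q where "q = b - sum y A"
  have "A \<inter> {..<L} = A" using L(1) by auto
  then have q: "\<bar>q\<bar> < 2 * \<epsilon>" using Ay[of L] b by (simp add: q_def)
  obtain D where D: "finite D" "D \<subseteq> {L..}" "\<bar>q - sum y D\<bar> < \<epsilon> / 8" "(\<Sum>n\<in>D. \<bar>y n\<bar>) \<le> \<bar>q\<bar>"
    using approximation_by_one_sign[OF y, of "\<epsilon> / 8" L q] eps by auto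
  have sub: "\<bar>sum y E\<bar> \<le> 2 * \<epsilon>" "\<bar>sum x E\<bar> \<le> \<epsilon> / 8" if E: "E \<subseteq> D" for E
  proof -
    have absE: "(\<Sum>n\<in>E. \<bar>y n\<bar>) \<le> 2 * \<epsilon>"
      using sum_mono2[OF D(1) E, of "\<lambda>n. \<bar>y n\<bar>"] D(4) q by simp
    then show "\<bar>sum y E\<bar> \<le> 2 * \<epsilon>" using sum_abs[of y E] by linarith
    have "\<bar>sum x E\<bar> \<le> (\<Sum>n\<in>E. \<bar>x n\<bar>)" by (rule sum_abs)
    also have "\<dots> \<le> (\<Sum>n\<in>E. \<bar>y n\<bar> / 16)"
      using E D(2) L(3) by (intro sum_mono dom) force
    also have "\<dots> = (\<Sum>n\<in>E. \<bar>y n\<bar>) / 16" by (simp add: sum_divide_distrib)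
    finally show "\<bar>sum x E\<bar> \<le> \<epsilon> / 8" using absE by simp
  qed
  have disj: "A \<inter> D = {}" using L(1) D(2) by force
  have sum_cut: "sum z ((A \<union> D) \<inter> {..<n}) = sum z (A \<inter> {..<n}) + sum z (D \<inter> {..<n})"
    for z :: "nat \<Rightarrow> real" and n
    unfolding Int_Un_distrib2 using A(1) D(1) disj by (intro sum.union_disjoint) auto
  have "norm (p - sum v (A \<union> D)) < 3 / 4 * \<epsilon>"
  proof -
    have "norm (p - sum v (A \<union> D))
        \<le> \<bar>a - sum x A - sum x D\<bar> + \<bar>q - sum y D\<bar>"
      using norm_Pair_le[of "a - sum x A - sum x D" "q - sum y D"] A(1) D(1) disj
      by (simp add: ab sum_v q_def sum.union_disjoint diff_diff_eq)
    also have "\<dots> < 3 / 4 * \<epsilon>" using A(3) sub(2)[OF order_refl] D(3) by linarith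
    finally show ?thesis .
  qed
  moreover have "norm (sum v ((A \<union> D) \<inter> {..<n})) \<le> 5 * \<epsilon>" for n
  proof -
    have "D \<inter> {..<n} \<subseteq> D" by auto
    then show ?thesis
      using norm_Pair_le[of "sum x ((A \<union> D) \<inter> {..<n})" "sum y ((A \<union> D) \<inter> {..<n})"]
        sub[of "D \<inter> {..<n}"] Ax[of n] Ay[of n] eps
      unfolding sum_v sum_cut real_norm_def by linarith
  qed
  moreover have "finite (A \<union> D)" "A \<union> D \<subseteq> {N..}" using A D L(2) by auto
  ultimately show ?thesis by blast
qed

text \<open>
  The value 16 is the one needed for \<open>block_reducing_error\<close>.  A vanishing \<open>x n\<close> would give
  the quotient 0, so it cannot occur where the quotient is at least 16.
\<close>

lemma reduction_property_dominated:
  assumes "reduction_property x y"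
  obtains K where "\<And>n. n \<ge> K \<Longrightarrow> \<bar>x n\<bar> \<le> \<bar>y n\<bar> / 16"
proof -
  have "eventually (\<lambda>n. 16 \<le> \<bar>y n\<bar> / \<bar>x n\<bar>) sequentially"
    using assms unfolding reduction_property_def filterlim_at_top by blast
  then obtain K where K: "\<And>n. n \<ge> K \<Longrightarrow> 16 \<le> \<bar>y n\<bar> / \<bar>x n\<bar>"
    by (auto simp: eventually_sequentially)
  have "\<bar>x n\<bar> \<le> \<bar>y n\<bar> / 16" if "n \<ge> K" for n
    using K[OF that] by (cases "x n = 0") (auto simp: field_simps)
  then show thesis using that by blast
qed

theorem theorem3p3:
  fixes x y :: "nat \<Rightarrow> real"
  assumes "conditionally_convergent (\<lambda>n. (x n, y n))"
    and "reduction_property x y"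
  shows "achievement_set (\<lambda>n. (x n, y n)) = (UNIV :: (real \<times> real) set)"
proof -
  have v: "summable (\<lambda>n. (x n, y n))" "\<not> summable (\<lambda>n. norm (x n, y n))"
    using assms(1) by (auto simp: conditionally_convergent_def)
  obtain K where K: "\<And>n. n \<ge> K \<Longrightarrow> \<bar>x n\<bar> \<le> \<bar>y n\<bar> / 16"
    using reduction_property_dominated[OF assms(2)] by blast
  have y: "summable y"
    using bounded_linear.summable[OF bounded_linear_snd v(1)] by simp
  have y_abs: "\<not> summable (\<lambda>n. \<bar>y n\<bar>)"
  proof
    assume "summable (\<lambda>n. \<bar>y n\<bar>)"
    then have "summable (\<lambda>n. 2 * \<bar>y n\<bar>)" by (rule summable_mult)
    moreover have "norm (norm (x n, y n)) \<le> 2 * \<bar>y n\<bar>" if "n \<ge> K" for n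
      using norm_Pair_le[of "x n" "y n"] K[OF that] by simp
    ultimately have "summable (\<lambda>n. norm (x n, y n))"
      by (rule summable_comparison_test'[where N = K])
    with v(2) show False by contradiction
  qed
  have "t \<in> achievement_set (\<lambda>n. (x n, y n))" for t
    by (rule achievement_set_if_error_reducible[where c = "3 / 4" and C = 5])
      (use block_reducing_error[OF assms(2) y y_abs K] in auto)
  then show ?thesis by blast
qed

end
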